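(* Suppose there exist symmetric $2$-$(n,k_i,\lambda_i)$ designs ($i=1,2$) whose incidence matrices $N_1,N_2$ satisfy $N_1N_2^T+N_2N_1^T=\mu_1I_n+\mu_2(J_n-I_n)$. Then for every integer $m\ge2$ there exists a global decomposable STD$(n)$ self-dual rectangular design with parameters $v=b=mn$, $r=k=k_1+(m-1)k_2$, $\lambda_1'=\lambda_1+(m-1)\lambda_2$, $\lambda_2'=(m-2)k_2+\mu_1$, $\lambda_3'=(m-2)\lambda_2+\mu_2$, $m$, $n$ (here $\lambda_1',\lambda_2',\lambda_3'$ are the row, column and other concurrences respectively).
   Context: A symmetric $2$-$(n,k,\lambda)$ design has $n$ treatments, $n$ blocks of size $k$, and any two distinct treatments occur together in $\lambda$ blocks. A rectangular design (RD) on $v=mn$ treatments arranged in an $m\times n$ array has $b$ blocks of size $k$, replication $r$, and any two distinct treatments occur together in $\lambda_1$ blocks if in the same row, $\lambda_2$ if in the same column, $\lambda_3$ otherwise. It is self-dual (SDRD) if the design with the transposed incidence matrix is an RD with the same parameters. It is STD$(n)$ if its incidence matrix (rows grouped by rows of the array) is partitioned into $n\times n$ submatrices each having constant row sums and constant column sums. An SDRD with incidence matrix $N=[N_{ij}]_{i,j=1,\dots,m}$ ($n\times n$ blocks) is global decomposable if each $N_{ij}$ is the incidence matrix of a symmetric design and, with $R_i=(N_{i1}|\cdots|N_{im})$, $R_iR_i^T=kI_n+\lambda_1(J_n-I_n)$ and $R_iR_j^T=\lambda_2I_n+\lambda_3(J_n-I_n)$ for $i\ne j$. *)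

theory Defs
  imports "Jordan_Normal_Form.Matrix"
begin

definition incidence_matrix :: "nat \<Rightarrow> nat \<Rightarrow> int mat \<Rightarrow> bool" where
  "incidence_matrix v b N \<longleftrightarrow>
     N \<in> carrier_mat v b \<and> (\<forall>x<v. \<forall>j<b. N $$ (x, j) \<in> {0, 1})"

definition block_size :: "int mat \<Rightarrow> nat \<Rightarrow> nat" where
  "block_size N j = card {x. x < dim_row N \<and> N $$ (x, j) = 1}"

definition replication :: "int mat \<Rightarrow> nat \<Rightarrow> nat" where
  "replication N x = card {j. j < dim_col N \<and> N $$ (x, j) = 1}"

definition concurrence :: "int mat \<Rightarrow> nat \<Rightarrow> nat \<Rightarrow> nat" where
  "concurrence N x y = card {j. j < dim_col N \<and> N $$ (x, j) = 1 \<and> N $$ (y, j) = 1}"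

text \<open>Trivial parameters (such as \<open>k = 0\<close>, \<open>k = 1\<close> or \<open>k = n\<close>) are allowed.\<close>

definition symmetric_design :: "nat \<Rightarrow> nat \<Rightarrow> nat \<Rightarrow> int mat \<Rightarrow> bool" where
  "symmetric_design n k l N \<longleftrightarrow>
     incidence_matrix n n N \<and>
     (\<forall>j<n. block_size N j = k) \<and>
     (\<forall>x<n. \<forall>y<n. x \<noteq> y \<longrightarrow> concurrence N x y = l)"

text \<open>Treatment \<open>x < m * n\<close> sits in row \<open>x div n\<close> and column \<open>x mod n\<close> of the
  \<open>m \<times> n\<close> array, so the rows of the incidence matrix are grouped by rows of the array.\<close>

definition rectangular_design ::
  "nat \<Rightarrow> nat \<Rightarrow> nat \<Rightarrow> nat \<Rightarrow> nat \<Rightarrow> nat \<Rightarrow> nat \<Rightarrow> nat \<Rightarrow> nat \<Rightarrow> int mat \<Rightarrow> bool" where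
  "rectangular_design v b r k l1 l2 l3 m n N \<longleftrightarrow>
     v = m * n \<and> incidence_matrix v b N \<and>
     (\<forall>j<b. block_size N j = k) \<and>
     (\<forall>x<v. replication N x = r) \<and>
     (\<forall>x<v. \<forall>y<v. x \<noteq> y \<longrightarrow>
        concurrence N x y =
          (if x div n = y div n then l1 else if x mod n = y mod n then l2 else l3))"

definition self_dual_rectangular_design ::
  "nat \<Rightarrow> nat \<Rightarrow> nat \<Rightarrow> nat \<Rightarrow> nat \<Rightarrow> nat \<Rightarrow> nat \<Rightarrow> nat \<Rightarrow> nat \<Rightarrow> int mat \<Rightarrow> bool" where
  "self_dual_rectangular_design v b r k l1 l2 l3 m n N \<longleftrightarrow>
     rectangular_design v b r k l1 l2 l3 m n N \<and>
     rectangular_design v b r k l1 l2 l3 m n (transpose_mat N)"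

definition sub_block :: "nat \<Rightarrow> int mat \<Rightarrow> nat \<Rightarrow> nat \<Rightarrow> int mat" where
  "sub_block n N i j = mat n n (\<lambda>(x, y). N $$ (i * n + x, j * n + y))"

definition row_block :: "nat \<Rightarrow> int mat \<Rightarrow> nat \<Rightarrow> int mat" where
  "row_block n N i = mat n (dim_col N) (\<lambda>(x, y). N $$ (i * n + x, y))"

definition STD :: "nat \<Rightarrow> int mat \<Rightarrow> bool" where
  "STD n N \<longleftrightarrow> (\<exists>p q. N \<in> carrier_mat (p * n) (q * n) \<and>
     (\<forall>i<p. \<forall>j<q.
        (\<exists>s. \<forall>x<n. (\<Sum>y<n. sub_block n N i j $$ (x, y)) = s) \<and>
        (\<exists>t. \<forall>y<n. (\<Sum>x<n. sub_block n N i j $$ (x, y)) = t)))"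

definition J_mat :: "nat \<Rightarrow> int mat" where
  "J_mat n = mat n n (\<lambda>_. 1)"

definition global_decomposable ::
  "nat \<Rightarrow> nat \<Rightarrow> nat \<Rightarrow> nat \<Rightarrow> nat \<Rightarrow> nat \<Rightarrow> int mat \<Rightarrow> bool" where
  "global_decomposable k l1 l2 l3 m n N \<longleftrightarrow>
     (\<forall>i<m. \<forall>j<m. \<exists>k' l'. symmetric_design n k' l' (sub_block n N i j)) \<and>
     (\<forall>i<m. row_block n N i * transpose_mat (row_block n N i) =
        int k \<cdot>\<^sub>m 1\<^sub>m n + int l1 \<cdot>\<^sub>m (J_mat n - 1\<^sub>m n)) \<and>
     (\<forall>i<m. \<forall>j<m. i \<noteq> j \<longrightarrow>
        row_block n N i * transpose_mat (row_block n N j) =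
        int l2 \<cdot>\<^sub>m 1\<^sub>m n + int l3 \<cdot>\<^sub>m (J_mat n - 1\<^sub>m n))"

end

theory Submission imports Defs begin

text \<open>Put \<open>N\<^sub>1\<close> on the diagonal blocks and \<open>N\<^sub>2\<close> on all others. The products \<open>R\<^sub>i R\<^sub>j\<^sup>T\<close> are then
  \<open>N\<^sub>1 N\<^sub>1\<^sup>T + (m - 1) N\<^sub>2 N\<^sub>2\<^sup>T\<close> for \<open>i = j\<close> and
  \<open>N\<^sub>1 N\<^sub>2\<^sup>T + N\<^sub>2 N\<^sub>1\<^sup>T + (m - 2) N\<^sub>2 N\<^sub>2\<^sup>T\<close> for \<open>i \<noteq> j\<close>.
  Self-duality needs the same identities for the transposes. An integer matrix with constant line
  sums whose Gram matrix lies in the span of \<open>I\<close> and \<open>J\<close> commutes with that Gram matrix and is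
  therefore normal; applied to \<open>N\<^sub>1\<close>, \<open>N\<^sub>2\<close> and \<open>N\<^sub>1 + N\<^sub>2\<close>, this yields all of them.

  Constant row sums can fail only when \<open>k = 1\<close> and \<open>n \<ge> 2\<close>. In that case the hypothesis on
  \<open>N\<^sub>1 N\<^sub>2\<^sup>T + N\<^sub>2 N\<^sub>1\<^sup>T\<close> leaves so few parameters that the pair can be replaced by explicit
  matrices: the identity together with zero, the identity, or a cyclic shift for \<open>n \<le> 3\<close>.\<close>

section \<open>Matrices commuting with their Gram matrix\<close>

definition trace_mat :: "int mat \<Rightarrow> int" where
  "trace_mat A = (\<Sum>i<dim_row A. A $$ (i, i))"

lemma index_mult_mat_sum:
  fixes A B :: "int mat"
  assumes "A \<in> carrier_mat a n" "B \<in> carrier_mat n b" "i < a" "j < b"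
  shows "(A * B) $$ (i, j) = (\<Sum>q<n. A $$ (i, q) * B $$ (q, j))"
  using assms by (auto simp: scalar_prod_def lessThan_atLeast0 intro!: sum.cong)

lemma trace_mult_commute:
  assumes A: "A \<in> carrier_mat n m" and B: "B \<in> carrier_mat m n"
  shows "trace_mat (A * B) = trace_mat (B * A)"
proof -
  have "trace_mat (A * B) = (\<Sum>i<n. \<Sum>q<m. A $$ (i, q) * B $$ (q, i))"
    unfolding trace_mat_def using A index_mult_mat_sum[OF A B] by (intro sum.cong) auto
  also have "\<dots> = (\<Sum>q<m. \<Sum>i<n. A $$ (i, q) * B $$ (q, i))"
    by (rule sum.swap)
  also have "\<dots> = trace_mat (B * A)"
    unfolding trace_mat_def using B index_mult_mat_sum[OF B A]
    by (intro sum.cong) (auto simp: mult.commute)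
  finally show ?thesis .
qed

lemma trace_minus:
  assumes "A \<in> carrier_mat n n" "B \<in> carrier_mat n n"
  shows "trace_mat (A - B) = trace_mat A - trace_mat B"
  using assms by (auto simp: trace_mat_def sum_subtractf)

text \<open>The trace is the sum of the squares of all entries (the squared Frobenius norm), and
  integer squares summing to 0 all vanish.\<close>

lemma trace_mult_transpose_eq_0:
  assumes A: "A \<in> carrier_mat n n" and tr: "trace_mat (A * transpose_mat A) = 0"
  shows "A = 0\<^sub>m n n"
proof -
  have "trace_mat (A * transpose_mat A) = (\<Sum>i<n. \<Sum>q<n. (A $$ (i, q))\<^sup>2)"
    unfolding trace_mat_def
    using A index_mult_mat_sum[OF A, of "transpose_mat A" n]
    by (intro sum.cong) (auto simp: power2_eq_square)
  with tr have "\<forall>i<n. \<forall>q<n. A $$ (i, q) = 0"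
    by (simp add: sum_nonneg_eq_0_iff sum_nonneg)
  with A show ?thesis by (intro eq_matI) auto
qed

text \<open>With \<open>Q = N N\<^sup>T\<close>, \<open>M = N\<^sup>T N\<close> and \<open>N Q = Q N\<close>, cyclicity of the trace gives
  \<open>tr (M M) = tr (M Q) = tr (Q Q)\<close>, so the symmetric matrix \<open>M - Q\<close> has a square of trace 0.\<close>

lemma normal_if_commutes_with_gram:
  fixes N :: "int mat"
  assumes N: "N \<in> carrier_mat n n"
    and comm: "N * (N * transpose_mat N) = (N * transpose_mat N) * N"
  shows "transpose_mat N * N = N * transpose_mat N"
proof -
  define T where "T = transpose_mat N"
  define Q where "Q = N * T"
  define M where "M = T * N"
  define E where "E = M - Q"
  have c: "N \<in> carrier_mat n n" "T \<in> carrier_mat n n" "Q \<in> carrier_mat n n"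
    "M \<in> carrier_mat n n" "E \<in> carrier_mat n n"
    using N by (auto simp: T_def Q_def M_def E_def)
  have "transpose_mat M = M" "transpose_mat Q = Q"
    using N by (simp_all add: M_def Q_def T_def transpose_mult[of _ n n _ n])
  then have ET: "transpose_mat E = E"
    using c by (simp add: E_def transpose_minus[of _ n n])
  have NQ: "N * Q = Q * N" using comm unfolding Q_def T_def .
  have MM: "trace_mat (M * M) = trace_mat (Q * Q)"
  proof -
    have "M * M = T * (N * M)"
      unfolding M_def by (rule assoc_mult_mat[of _ n n _ n _ n]) (use c in auto)
    then have "trace_mat (M * M) = trace_mat (T * (N * M))" by (rule arg_cong)
    also have "\<dots> = trace_mat ((N * M) * T)"
      by (rule trace_mult_commute[of _ n n]) (use c in auto)
    also have "N * M = Q * N"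
      unfolding M_def Q_def by (rule assoc_mult_mat[of _ n n _ n _ n, symmetric]) (use c in auto)
    also have "Q * N * T = Q * Q"
      using assoc_mult_mat[OF c(3,1,2)] unfolding Q_def[symmetric] .
    finally show ?thesis .
  qed
  have MQ: "trace_mat (M * Q) = trace_mat (Q * Q)"
  proof -
    have "M * Q = T * (N * Q)"
      unfolding M_def by (rule assoc_mult_mat[OF c(2,1,3)])
    then have "trace_mat (M * Q) = trace_mat (T * (N * Q))" by (rule arg_cong)
    also have "\<dots> = trace_mat ((N * Q) * T)"
      by (rule trace_mult_commute[of _ n n]) (use c in auto)
    also have "N * Q * T = Q * Q"
      using assoc_mult_mat[OF c(3,1,2)] unfolding NQ Q_def[symmetric] .
    finally show ?thesis .
  qed
  have QM: "trace_mat (Q * M) = trace_mat (Q * Q)"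
    using MQ trace_mult_commute[OF c(3,4)] by (rule trans[rotated])
  have "E * E = M * E - Q * E"
    unfolding E_def by (rule minus_mult_distrib_mat[of _ n n _ _ n]) (use c in auto)
  also have "M * E = M * M - M * Q"
    unfolding E_def by (rule mult_minus_distrib_mat[OF c(4,4,3)])
  also have "Q * E = Q * M - Q * Q"
    unfolding E_def by (rule mult_minus_distrib_mat[OF c(3,4,3)])
  finally have EE: "E * E = M * M - M * Q - (Q * M - Q * Q)" .
  have c': "M * M \<in> carrier_mat n n" "M * Q \<in> carrier_mat n n"
    "Q * M \<in> carrier_mat n n" "Q * Q \<in> carrier_mat n n"
    using c by auto
  have "trace_mat (E * E) =
      trace_mat (M * M) - trace_mat (M * Q) - (trace_mat (Q * M) - trace_mat (Q * Q))"
    unfolding EE trace_minus[OF minus_carrier_mat[OF c'(2)] minus_carrier_mat[OF c'(4)]]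
      trace_minus[OF c'(1,2)] trace_minus[OF c'(3,4)] ..
  then have "trace_mat (E * E) = 0" unfolding MM MQ QM by simp
  then have E0: "E = 0\<^sub>m n n"
    using c by (intro trace_mult_transpose_eq_0) (simp_all add: ET)
  have "M $$ (i, j) = Q $$ (i, j)" if "i < n" "j < n" for i j
  proof -
    have "M $$ (i, j) - Q $$ (i, j) = E $$ (i, j)" using that c by (simp add: E_def)
    with E0 that show ?thesis by simp
  qed
  then have "M = Q"
    using c(3,4) by (intro eq_matI) auto
  then show ?thesis by (simp add: M_def Q_def T_def)
qed

text \<open>An entry of \<open>A\<close> times the transpose of \<open>B\<close>, written as a plain
  sum over \<open>n\<close> columns so that concurrences, line sums and block sums can be treated
  entrywise.\<close>

definition gram :: "nat \<Rightarrow> int mat \<Rightarrow> int mat \<Rightarrow> nat \<Rightarrow> nat \<Rightarrow> int" where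
  "gram n A B x y = (\<Sum>j<n. A $$ (x, j) * B $$ (y, j))"

lemma gram_index:
  assumes "A \<in> carrier_mat a n" "B \<in> carrier_mat b n" "x < a" "y < b"
  shows "(A * transpose_mat B) $$ (x, y) = gram n A B x y"
  using assms index_mult_mat_sum[of A a n "transpose_mat B" b x y] by (simp add: gram_def)

lemma sum_mult_delta_const:
  fixes f :: "nat \<Rightarrow> int"
  assumes "y < n"
  shows "(\<Sum>q<n. f q * (if q = y then a else b)) = (a - b) * f y + b * (\<Sum>q<n. f q)"
proof -
  have "(\<Sum>q<n. f q * (if q = y then a else b))
      = (\<Sum>q<n. (if q = y then (a - b) * f q else 0) + b * f q)"
    by (intro sum.cong) (auto simp: algebra_simps)
  also have "\<dots> = (a - b) * f y + b * (\<Sum>q<n. f q)"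
    using assms by (simp add: sum.distrib sum_distrib_left)
  finally show ?thesis .
qed

text \<open>The Gram matrix is \<open>(a - b) I + b J\<close>, and equal constant row and column
  sums give \<open>N J = k J = J N\<close>. Hence \<open>N\<close> commutes with its Gram matrix and
  is normal. The entries may be arbitrary integers.\<close>

lemma gram_transpose_eq:
  assumes N: "N \<in> carrier_mat n n"
    and rows: "\<And>x. x < n \<Longrightarrow> (\<Sum>j<n. N $$ (x, j)) = k"
    and cols: "\<And>j. j < n \<Longrightarrow> (\<Sum>x<n. N $$ (x, j)) = k"
    and g: "\<And>x y. x < n \<Longrightarrow> y < n \<Longrightarrow> gram n N N x y = (if x = y then a else b)"
    and xy: "x < n" "y < n"
  shows "gram n (transpose_mat N) (transpose_mat N) x y = (if x = y then a else b)"
proof -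
  let ?Q = "N * transpose_mat N"
  have Q: "?Q \<in> carrier_mat n n" using N by simp
  have Qi: "?Q $$ (i, j) = (if i = j then a else b)" if "i < n" "j < n" for i j
    using gram_index[OF N N that] g that by simp
  have "N * ?Q = ?Q * N"
  proof (rule eq_matI)
    fix i j assume "i < dim_row (?Q * N)" "j < dim_col (?Q * N)"
    then have ij: "i < n" "j < n" using N by auto
    have "(N * ?Q) $$ (i, j) = (\<Sum>q<n. N $$ (i, q) * (if q = j then a else b))"
      unfolding index_mult_mat_sum[OF N Q ij] using ij by (intro sum.cong) (auto simp: Qi)
    also have "\<dots> = (a - b) * N $$ (i, j) + b * k"
      using sum_mult_delta_const[of j n "\<lambda>q. N $$ (i, q)"] ij rows by simp
    also have "\<dots> = (\<Sum>q<n. N $$ (q, j) * (if q = i then a else b))"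
      using sum_mult_delta_const[of i n "\<lambda>q. N $$ (q, j)"] ij cols by simp
    also have "\<dots> = (?Q * N) $$ (i, j)"
      unfolding index_mult_mat_sum[OF Q N ij] using ij by (intro sum.cong) (auto simp: Qi)
    finally show "(N * ?Q) $$ (i, j) = (?Q * N) $$ (i, j)" .
  qed (use N in auto)
  then have "transpose_mat N * N = ?Q"
    by (rule normal_if_commutes_with_gram[OF N])
  then show ?thesis
    using gram_index[of "transpose_mat N" n n "transpose_mat N" n x y] N xy Qi by simp
qed

section \<open>Regular designs and compatible pairs\<close>

text \<open>By \<open>regular_design_iff\<close> this is \<open>symmetric_design\<close> together
  with row sums \<open>k\<close>, expressed through sums instead of cardinalities.\<close>

definition regular_design :: "nat \<Rightarrow> nat \<Rightarrow> nat \<Rightarrow> int mat \<Rightarrow> bool" where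
  "regular_design n k l N \<longleftrightarrow> incidence_matrix n n N \<and>
     (\<forall>x<n. (\<Sum>j<n. N $$ (x, j)) = int k) \<and>
     (\<forall>j<n. (\<Sum>x<n. N $$ (x, j)) = int k) \<and>
     (\<forall>x<n. \<forall>y<n. x \<noteq> y \<longrightarrow> gram n N N x y = int l)"

text \<open>All parameters are explicit, so that any other pair with the same parameters can take
  the place of a given one.\<close>

definition compatible_pair ::
  "nat \<Rightarrow> nat \<Rightarrow> nat \<Rightarrow> nat \<Rightarrow> nat \<Rightarrow> nat \<Rightarrow> nat \<Rightarrow> int mat \<Rightarrow> int mat \<Rightarrow> bool" where
  "compatible_pair n k1 l1 k2 l2 m1 m2 A B \<longleftrightarrow>
     regular_design n k1 l1 A \<and> regular_design n k2 l2 B \<and>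
     (\<forall>x<n. \<forall>y<n. gram n A B x y + gram n B A x y = (if x = y then int m1 else int m2))"

text \<open>Entries in \<open>{0, 1}\<close> equal their own squares.\<close>

lemma gram_diag:
  assumes "incidence_matrix v b N" "x < v"
  shows "gram b N N x x = (\<Sum>j<b. N $$ (x, j))"
  unfolding gram_def
proof (intro sum.cong refl)
  fix j assume "j \<in> {..<b}"
  then have "N $$ (x, j) \<in> {0, 1}" using assms by (auto simp: incidence_matrix_def)
  then show "N $$ (x, j) * N $$ (x, j) = N $$ (x, j)" by auto
qed

lemma regular_design_gram:
  assumes "regular_design n k l N" "x < n" "y < n"
  shows "gram n N N x y = (if x = y then int k else int l)"
  using assms gram_diag[of n n N x] by (auto simp: regular_design_def)

lemma incidence_matrix_transpose:
  "incidence_matrix v b N \<Longrightarrow> incidence_matrix b v (transpose_mat N)"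
  by (fastforce simp: incidence_matrix_def)

lemma regular_design_transpose:
  assumes N: "regular_design n k l N"
  shows "regular_design n k l (transpose_mat N)"
proof -
  have c: "N \<in> carrier_mat n n" using N by (auto simp: regular_design_def incidence_matrix_def)
  have "gram n (transpose_mat N) (transpose_mat N) x y = (if x = y then int k else int l)"
    if "x < n" "y < n" for x y
    by (rule gram_transpose_eq[OF c, of "int k"])
       (use N that in \<open>auto simp: regular_design_def regular_design_gram[OF N]\<close>)
  then show ?thesis
    using N c by (auto simp: regular_design_def incidence_matrix_transpose)
qed

lemma gram_add:
  assumes "A \<in> carrier_mat a n" "B \<in> carrier_mat a n" "x < a" "y < a"
  shows "gram n (A + B) (A + B) x y =
    gram n A A x y + gram n B B x y + (gram n A B x y + gram n B A x y)"
  using assms by (simp add: gram_def sum.distrib[symmetric] algebra_simps)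

text \<open>The mixed Gram matrices dualise by polarisation: \<open>A\<close>, \<open>B\<close> and \<open>A + B\<close> all have constant
  line sums and a Gram matrix in the span of \<open>I\<close> and \<open>J\<close>, hence are normal.\<close>

lemma compatible_pair_transpose:
  assumes P: "compatible_pair n k1 l1 k2 l2 m1 m2 A B"
  shows "compatible_pair n k1 l1 k2 l2 m1 m2 (transpose_mat A) (transpose_mat B)"
proof -
  have A: "regular_design n k1 l1 A" and B: "regular_design n k2 l2 B"
    and AB: "\<And>x y. x < n \<Longrightarrow> y < n \<Longrightarrow>
      gram n A B x y + gram n B A x y = (if x = y then int m1 else int m2)"
    using P by (auto simp: compatible_pair_def)
  note At = regular_design_transpose[OF A] and Bt = regular_design_transpose[OF B]
  have c: "A \<in> carrier_mat n n" "B \<in> carrier_mat n n"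
    using A B by (auto simp: regular_design_def incidence_matrix_def)
  have "gram n (transpose_mat A) (transpose_mat B) x y
      + gram n (transpose_mat B) (transpose_mat A) x y = (if x = y then int m1 else int m2)"
    if xy: "x < n" "y < n" for x y
  proof -
    \<comment> \<open>\<open>A + B\<close> may have entries 2 and is not an incidence matrix;
      \<open>gram_transpose_eq\<close> only asks for an integer matrix.\<close>
    have "gram n (transpose_mat (A + B)) (transpose_mat (A + B)) x y
        = (if x = y then int k1 + int k2 + int m1 else int l1 + int l2 + int m2)"
    proof (rule gram_transpose_eq[where k = "int k1 + int k2"])
      fix i j assume "i < n" "j < n"
      then show "gram n (A + B) (A + B) i j
          = (if i = j then int k1 + int k2 + int m1 else int l1 + int l2 + int m2)"
        unfolding gram_add[OF c \<open>i < n\<close> \<open>j < n\<close>]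
        by (simp add: AB regular_design_gram[OF A] regular_design_gram[OF B])
    qed (use A B c xy in \<open>auto simp: regular_design_def sum.distrib\<close>)
    \<comment> \<open>Subtracting the Gram matrices of the two transposes leaves the mixed
      terms.\<close>
    then show ?thesis
      using gram_add[of "transpose_mat A" n n "transpose_mat B" x y] c xy
      by (auto simp: transpose_add[OF c] regular_design_gram[OF At] regular_design_gram[OF Bt]
          split: if_splits)
  qed
  with At Bt show ?thesis by (simp add: compatible_pair_def)
qed

section \<open>Concurrences, replications and block sizes as sums\<close>

lemma incidence_entry:
  "incidence_matrix v b N \<Longrightarrow> x < v \<Longrightarrow> j < b \<Longrightarrow> N $$ (x, j) = 0 \<or> N $$ (x, j) = 1"
  by (auto simp: incidence_matrix_def)

lemma concurrence_eq_gram: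
  assumes N: "incidence_matrix v b N" and "x < v" "y < v"
  shows "int (concurrence N x y) = gram b N N x y"
proof -
  have "gram b N N x y = (\<Sum>j<b. if N $$ (x, j) = 1 \<and> N $$ (y, j) = 1 then 1 else 0)"
    unfolding gram_def using incidence_entry[OF N] assms by (intro sum.cong) fastforce+
  also have "\<dots> = int (card ({..<b} \<inter> {j. N $$ (x, j) = 1 \<and> N $$ (y, j) = 1}))"
    by (simp add: sum.If_cases)
  also have "{..<b} \<inter> {j. N $$ (x, j) = 1 \<and> N $$ (y, j) = 1}
      = {j. j < dim_col N \<and> N $$ (x, j) = 1 \<and> N $$ (y, j) = 1}"
    using N by (auto simp: incidence_matrix_def)
  finally show ?thesis by (simp add: concurrence_def)
qed

lemma replication_eq_sum:
  assumes N: "incidence_matrix v b N" and "x < v"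
  shows "int (replication N x) = (\<Sum>j<b. N $$ (x, j))"
proof -
  have "replication N x = concurrence N x x" by (simp add: replication_def concurrence_def)
  then show ?thesis using concurrence_eq_gram[OF N] gram_diag[OF N] assms by simp
qed

lemma block_size_eq_sum:
  assumes N: "incidence_matrix v b N" and j: "j < b"
  shows "int (block_size N j) = (\<Sum>x<v. N $$ (x, j))"
proof -
  have "block_size N j = replication (transpose_mat N) j"
    using N j by (auto simp: block_size_def replication_def incidence_matrix_def intro!: arg_cong[where f = card])
  then show ?thesis
    using replication_eq_sum[OF incidence_matrix_transpose[OF N] j] N j
    by (auto simp: incidence_matrix_def intro!: sum.cong)
qed

lemma regular_design_iff:
  "regular_design n k l N \<longleftrightarrow> symmetric_design n k l N \<and> (\<forall>x<n. (\<Sum>j<n. N $$ (x, j)) = int k)"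
proof (cases "incidence_matrix n n N")
  case True
  have "block_size N j = k \<longleftrightarrow> (\<Sum>x<n. N $$ (x, j)) = int k" if "j < n" for j
    using block_size_eq_sum[OF True that] by linarith
  moreover have "concurrence N x y = l \<longleftrightarrow> gram n N N x y = int l" if "x < n" "y < n" for x y
    using concurrence_eq_gram[OF True that] by linarith
  ultimately show ?thesis
    using True by (auto simp: regular_design_def symmetric_design_def)
next
  case False
  then show ?thesis by (simp add: regular_design_def symmetric_design_def)
qed

text \<open>Summing over \<open>y\<close> collapses each column of \<open>B\<close> to
  \<open>k\<close>; in matrix form, \<open>A B^T 1 = k A 1\<close> for the all-one vector
  \<open>1\<close>.\<close>

lemma sum_gram:
  assumes "\<And>j. j < n \<Longrightarrow> (\<Sum>y<n. B $$ (y, j)) = k"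
  shows "(\<Sum>y<n. gram n A B x y) = k * (\<Sum>j<n. A $$ (x, j))"
proof -
  have "(\<Sum>y<n. gram n A B x y) = (\<Sum>j<n. \<Sum>y<n. A $$ (x, j) * B $$ (y, j))"
    unfolding gram_def by (rule sum.swap)
  also have "\<dots> = (\<Sum>j<n. A $$ (x, j) * (\<Sum>y<n. B $$ (y, j)))"
    by (simp add: sum_distrib_left)
  also have "\<dots> = (\<Sum>j<n. k * A $$ (x, j))"
    using assms by (intro sum.cong) auto
  finally show ?thesis by (simp add: sum_distrib_left)
qed

lemma sum_if_one:
  fixes a b :: int
  assumes "i < m"
  shows "(\<Sum>p<m. if i = p then a else b) = a + (int m - 1) * b"
proof -
  have "(\<Sum>p<m. if i = p then a else b) = (\<Sum>p<m. (if i = p then a - b else 0) + b)"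
    by (intro sum.cong) auto
  with assms show ?thesis by (simp add: sum.distrib algebra_simps)
qed

lemma sum_if_two:
  fixes a b c :: int
  assumes "i < m" "j < m" "i \<noteq> j"
  shows "(\<Sum>p<m. if i = p then a else if j = p then c else b) = a + c + (int m - 2) * b"
proof -
  have "(\<Sum>p<m. if i = p then a else if j = p then c else b)
      = (\<Sum>p<m. (if i = p then a - b else 0) + (if j = p then c - b else 0) + b)"
    using assms by (intro sum.cong) auto
  with assms show ?thesis by (simp add: sum.distrib algebra_simps)
qed

section \<open>Row sums of symmetric designs\<close>

lemma symmetric_design_incidence: "symmetric_design n k l N \<Longrightarrow> incidence_matrix n n N"
  by (simp add: symmetric_design_def)

lemma symmetric_design_col_sum:
  assumes "symmetric_design n k l N" "j < n"
  shows "(\<Sum>x<n. N $$ (x, j)) = int k"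
  using block_size_eq_sum[OF symmetric_design_incidence[OF assms(1)] assms(2)] assms
  by (simp add: symmetric_design_def)

lemma symmetric_design_sum_row_sums:
  assumes "symmetric_design n k l N"
  shows "(\<Sum>x<n. \<Sum>j<n. N $$ (x, j)) = int n * int k"
  by (subst sum.swap) (simp add: symmetric_design_col_sum[OF assms])

text \<open>This is the count \<open>r (k - 1) = (n - 1) l\<close>: row \<open>x\<close> of the Gram
  matrix is summed once through the column sums and once through its diagonal and off-diagonal
  entries.\<close>

lemma symmetric_design_row_count:
  assumes N: "symmetric_design n k l N" and x: "x < n"
  shows "(\<Sum>j<n. N $$ (x, j)) * (int k - 1) = (int n - 1) * int l"
proof -
  let ?r = "\<Sum>j<n. N $$ (x, j)"
  note inc = symmetric_design_incidence[OF N]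
  have "(\<Sum>y<n. gram n N N x y) = (\<Sum>y<n. if x = y then ?r else int l)"
    using N x gram_diag[OF inc] concurrence_eq_gram[OF inc, symmetric]
    by (intro sum.cong) (auto simp: symmetric_design_def)
  then have "int k * ?r = ?r + (int n - 1) * int l"
    using sum_gram[of n N "int k" N x] symmetric_design_col_sum[OF N] sum_if_one[OF x] by simp
  then show ?thesis by (simp add: algebra_simps)
qed

text \<open>The exception is real: repeated singleton blocks satisfy the definition.\<close>

lemma symmetric_design_irregular:
  assumes N: "symmetric_design n k l N" and irr: "\<not> regular_design n k l N"
  shows "k = 1 \<and> l = 0 \<and> n \<ge> 2"
proof -
  let ?r = "\<lambda>x. \<Sum>j<n. N $$ (x, j)"
  obtain x where x: "x < n" "?r x \<noteq> int k"
    using N irr by (auto simp: regular_design_iff)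
  have n: "n \<ge> 2"
  proof (rule ccontr)
    assume "\<not> n \<ge> 2"
    with x have "n = 1" "x = 0" by auto
    with x symmetric_design_col_sum[OF N, of 0] show False by simp
  qed
  \<comment> \<open>Row sums average to \<open>k\<close>, so summing the row count over all rows
    gives \<open>k (k - 1) = (n - 1) l\<close>. Compared with row \<open>x\<close>, whose sum
    differs from \<open>k\<close>, this forces \<open>k = 1\<close>.\<close>
  have "int n * (int k * (int k - 1)) = (\<Sum>x<n. ?r x) * (int k - 1)"
    using symmetric_design_sum_row_sums[OF N] by simp
  also have "\<dots> = (\<Sum>x<n. (int n - 1) * int l)"
    by (subst sum_distrib_right) (simp add: symmetric_design_row_count[OF N])
  finally have "int n * (int k * (int k - 1)) = int n * ((int n - 1) * int l)" by simp
  with n have "int k * (int k - 1) = (int n - 1) * int l" by auto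
  with symmetric_design_row_count[OF N x(1)] have "?r x * (int k - 1) = int k * (int k - 1)"
    by simp
  with x(2) have k: "k = 1" by simp
  with symmetric_design_row_count[OF N x(1)] n have "l = 0" by auto
  with k n show ?thesis by simp
qed

section \<open>Explicit pairs replacing irregular ones\<close>

lemma compatible_pair_swap:
  "compatible_pair n k1 l1 k2 l2 m1 m2 A B \<Longrightarrow> compatible_pair n k2 l2 k1 l1 m1 m2 B A"
  by (simp add: compatible_pair_def add.commute)

lemma gram_one_one: "x < n \<Longrightarrow> y < n \<Longrightarrow> gram n (1\<^sub>m n) (1\<^sub>m n) x y = (if x = y then 1 else 0)"
proof -
  assume xy: "x < n" "y < n"
  then have "gram n (1\<^sub>m n) (1\<^sub>m n) x y = (\<Sum>j<n. if j = x then (if x = y then 1 else 0) else 0)"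
    unfolding gram_def by (intro sum.cong) auto
  with xy show ?thesis by simp
qed

lemma regular_design_one: "regular_design n 1 0 (1\<^sub>m n)"
  by (auto simp: regular_design_def incidence_matrix_def gram_one_one cong: if_cong)

lemma compatible_pair_one_one: "compatible_pair n 1 0 1 0 2 0 (1\<^sub>m n) (1\<^sub>m n)"
  using regular_design_one by (auto simp: compatible_pair_def gram_one_one)

lemma compatible_pair_one_zero: "compatible_pair n 1 0 0 0 0 0 (1\<^sub>m n) (0\<^sub>m n n)"
  using regular_design_one
  by (auto simp: compatible_pair_def regular_design_def incidence_matrix_def gram_def)

text \<open>With \<open>P\<close> the shift, the mixed sum is \<open>P + P^T\<close>. For
  \<open>n = 2\<close> this is \<open>2 (J - I)\<close>, as \<open>P\<close> is symmetric; for
  \<open>n = 3\<close> the two shifts add up to \<open>J - I\<close>.\<close>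

lemma compatible_pair_one_cycle:
  assumes "n = 2 \<and> m2 = 2 \<or> n = 3 \<and> m2 = 1"
  shows "compatible_pair n 1 0 1 0 0 m2 (1\<^sub>m n)
    (mat n n (\<lambda>(x, y). if y = (x + 1) mod n then 1 else 0))"
proof -
  have all: "(\<forall>x<2. Q x) \<longleftrightarrow> Q 0 \<and> Q 1" "(\<forall>x<3. Q x) \<longleftrightarrow> Q 0 \<and> Q 1 \<and> Q 2" for Q :: "nat \<Rightarrow> bool"
    by (auto simp: numeral_2_eq_2 numeral_3_eq_3 less_Suc_eq)
  have set: "{..<2} = {0, 1::nat}" "{..<3} = {0, 1, 2::nat}" by auto
  show ?thesis
    using assms
    by (elim disjE) (simp_all add: compatible_pair_def regular_design_def incidence_matrix_def
        gram_def all set)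
qed

text \<open>Summing the mixed identity along rows relates the row sums of \<open>A\<close> and
  \<open>B\<close> to the parameters. This leaves \<open>k2 = 0\<close> if \<open>B\<close> is
  regular and \<open>m1 + (n - 1) m2 = 2\<close> otherwise, and each remaining case has an explicit
  pair.\<close>

lemma compatible_pair_if_irregular:
  assumes A: "symmetric_design n k1 l1 A" and irr: "\<not> regular_design n k1 l1 A"
    and B: "symmetric_design n k2 l2 B"
    and AB: "\<And>x y. x < n \<Longrightarrow> y < n \<Longrightarrow>
      gram n A B x y + gram n B A x y = (if x = y then int m1 else int m2)"
  shows "\<exists>A' B'. compatible_pair n k1 l1 k2 l2 m1 m2 A' B'"
proof -
  let ?rA = "\<lambda>x. \<Sum>j<n. A $$ (x, j)" and ?rB = "\<lambda>x. \<Sum>j<n. B $$ (x, j)"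
  let ?c = "int m1 + (int n - 1) * int m2"
  have k1: "k1 = 1" and l1: "l1 = 0" and n: "n \<ge> 2"
    using symmetric_design_irregular[OF A irr] by auto
  have row: "int k2 * ?rA x + ?rB x = ?c" if x: "x < n" for x
  proof -
    have "(\<Sum>y<n. gram n A B x y + gram n B A x y) = (\<Sum>y<n. if x = y then int m1 else int m2)"
      using x by (intro sum.cong) (auto simp: AB)
    then show ?thesis
      using sum_gram[of n B "int k2" A x] sum_gram[of n A "int k1" B x]
        symmetric_design_col_sum[OF A] symmetric_design_col_sum[OF B] sum_if_one[OF x]
      by (simp add: sum.distrib k1)
  qed
  \<comment> \<open>Averaged over all rows, \<open>?rA\<close> is 1 and \<open>?rB\<close> is
    \<open>k2\<close>, which determines \<open>?c\<close>.\<close>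
  have "int n * ?c = (\<Sum>x<n. int k2 * ?rA x + ?rB x)"
    by (simp add: row)
  also have "\<dots> = int n * (2 * int k2)"
    using symmetric_design_sum_row_sums[OF A] symmetric_design_sum_row_sums[OF B]
    by (simp add: sum.distrib sum_distrib_left[symmetric] k1)
  finally have c: "?c = 2 * int k2" using n by auto
  show ?thesis
  proof (cases "regular_design n k2 l2 B")
    case True
    obtain x where x: "x < n" "?rA x \<noteq> 1"
      using A irr k1 by (auto simp: regular_design_iff)
    \<comment> \<open>\<open>B\<close> contributes exactly \<open>k2\<close> to row
      \<open>x\<close>, so \<open>A\<close> must contribute \<open>k2\<close> as well, although
      \<open>?rA x\<close> is not 1; hence \<open>k2 = 0\<close>.\<close>
    have "int k2 * ?rA x = int k2 * 1"
      using row[OF x(1)] c True x(1) by (simp add: regular_design_def)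
    with x have k2: "k2 = 0" by auto
    moreover have "m1 = 0 \<and> m2 = 0"
    proof -
      have "(int n - 1) * int m2 \<ge> 0" using n by simp
      with c k2 have "int m1 = 0" "(int n - 1) * int m2 = 0" by linarith+
      with n show ?thesis by auto
    qed
    moreover have "l2 = 0"
      using symmetric_design_row_count[OF B x(1)] True x(1) k2 n by (auto simp: regular_design_def)
    ultimately show ?thesis using compatible_pair_one_zero k1 l1 by auto
  next
    case False
    then have k2: "k2 = 1" and l2: "l2 = 0"
      using symmetric_design_irregular[OF B] by auto
    \<comment> \<open>On the diagonal both mixed entries agree, so \<open>m1\<close> is even. This
      excludes the solution \<open>m1 = m2 = 1\<close> with \<open>n = 2\<close>.\<close>
    have "gram n A B 0 0 = gram n B A 0 0" by (simp add: gram_def mult.commute)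
    with AB[of 0 0] n have "int m1 = 2 * gram n A B 0 0" by simp
    then have "even (int m1)" by simp
    then have ev: "even m1" by simp
    \<comment> \<open>Writing \<open>n - 1\<close> as \<open>p + 1\<close> turns the integer
      equation for \<open>?c\<close> into one over the naturals.\<close>
    obtain p where p: "n = p + 2" using n by (metis add.commute le_Suc_ex)
    have s: "m1 + (p + 1) * m2 = 2"
    proof -
      have "int (m1 + (p + 1) * m2) = 2" using c k2 p by (simp add: algebra_simps)
      then show ?thesis by linarith
    qed
    show ?thesis
    proof (cases "m2 = 0")
      case True
      with s have "m1 = 2" by simp
      with True compatible_pair_one_one k1 l1 k2 l2 show ?thesis by auto
    next
      case False
      then have "(p + 1) * m2 \<ge> 1" by simp
      with s have "m1 \<le> 1" by linarith
      with ev have m1: "m1 = 0" by (cases "m1 = 1") auto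
      with s have "(p + 1) * m2 = 2" by simp
      moreover from this have "p + 1 \<le> 2" "m2 \<le> 2"
        by (metis dvd_imp_le dvd_triv_left dvd_triv_right zero_less_numeral)+
      \<comment> \<open>The factorisations of 2 are \<open>1 * 2\<close> and \<open>2 * 1\<close>;
        they give the two sizes covered by the cyclic shift.\<close>
      ultimately have "p = 0 \<and> m2 = 2 \<or> p = 1 \<and> m2 = 1"
        by (cases "p = 0"; cases "p = 1") auto
      then have "n = 2 \<and> m2 = 2 \<or> n = 3 \<and> m2 = 1" using p by auto
      then show ?thesis using compatible_pair_one_cycle k1 l1 k2 l2 m1 by blast
    qed
  qed
qed

lemma exists_compatible_pair:
  assumes A: "symmetric_design n k1 l1 A" and B: "symmetric_design n k2 l2 B"
    and AB: "\<And>x y. x < n \<Longrightarrow> y < n \<Longrightarrow>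
      gram n A B x y + gram n B A x y = (if x = y then int m1 else int m2)"
  shows "\<exists>A' B'. compatible_pair n k1 l1 k2 l2 m1 m2 A' B'"
proof (cases "regular_design n k1 l1 A")
  case False
  then show ?thesis using compatible_pair_if_irregular[OF A _ B] AB by blast
next
  case rA: True
  show ?thesis
  proof (cases "regular_design n k2 l2 B")
    case True
    with rA AB show ?thesis unfolding compatible_pair_def by blast
  next
    case False
    \<comment> \<open>The mixed identity is symmetric in the two designs, so their roles can be
      exchanged.\<close>
    have "\<exists>B' A'. compatible_pair n k2 l2 k1 l1 m1 m2 B' A'"
      using AB by (intro compatible_pair_if_irregular[OF B False A]) (simp add: add.commute)
    then show ?thesis using compatible_pair_swap by blast
  qed
qed

section \<open>The block construction\<close>

text \<open>Indices are split by \<open>div\<close> and \<open>mod\<close> as in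
  \<open>rectangular_design\<close>, so the row block of a treatment is its row of the
  array.\<close>

definition two_block_mat :: "nat \<Rightarrow> nat \<Rightarrow> int mat \<Rightarrow> int mat \<Rightarrow> int mat" where
  "two_block_mat m n A B = mat (m * n) (m * n)
     (\<lambda>(x, y). (if x div n = y div n then A else B) $$ (x mod n, y mod n))"

lemma block_index_less:
  fixes p q m n :: nat
  assumes "p < m" "q < n"
  shows "p * n + q < m * n"
proof -
  have "p * n + q < (p + 1) * n" using assms by simp
  also have "\<dots> \<le> m * n" using assms by (intro mult_le_mono1) simp
  finally show ?thesis .
qed

lemma div_mod_less:
  fixes x m n :: nat
  assumes "x < m * n"
  shows "x div n < m" "x mod n < n"
  using assms by (simp_all add: less_mult_imp_div_less) (cases n; simp)

lemma sum_blocks: "(\<Sum>j<m * n. f j) = (\<Sum>p<m. \<Sum>q<n. f (p * n + q :: nat))"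
proof -
  have "(\<Sum>q<n. f (p * n + q)) = sum f {p * n..<p * n + n}" for p
    using sum.shift_bounds_nat_ivl[of f 0 "p * n" n]
    by (simp add: lessThan_atLeast0 add.commute)
  then show ?thesis by (simp add: sum.nat_group)
qed

lemma two_block_mat_carrier: "two_block_mat m n A B \<in> carrier_mat (m * n) (m * n)"
  by (simp add: two_block_mat_def)

lemma two_block_mat_transpose:
  assumes "A \<in> carrier_mat n n" "B \<in> carrier_mat n n"
  shows "transpose_mat (two_block_mat m n A B) = two_block_mat m n (transpose_mat A) (transpose_mat B)"
  using assms div_mod_less(2) by (intro eq_matI) (auto simp: two_block_mat_def)

lemma sub_block_two_block_mat:
  assumes "A \<in> carrier_mat n n" "B \<in> carrier_mat n n" "i < m" "j < m"
  shows "sub_block n (two_block_mat m n A B) i j = (if i = j then A else B)"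
  using assms by (intro eq_matI) (auto simp: sub_block_def two_block_mat_def block_index_less)

lemma gram_two_block_mat:
  assumes "x < m * n" "y < m * n"
  shows "gram (m * n) (two_block_mat m n A B) (two_block_mat m n A B) x y =
    (\<Sum>p<m. gram n (if x div n = p then A else B) (if y div n = p then A else B) (x mod n) (y mod n))"
  unfolding gram_def sum_blocks using assms
  by (intro sum.cong refl) (auto simp: two_block_mat_def block_index_less)

text \<open>Within one block row, \<open>A\<close> meets itself once and \<open>B\<close> meets
  itself \<open>m - 1\<close> times. Two different block rows pair \<open>A\<close> with
  \<open>B\<close> in one block column, \<open>B\<close> with \<open>A\<close> in another, and
  \<open>B\<close> with itself in the remaining \<open>m - 2\<close>.\<close>

lemma gram_two_block_mat_cases:
  assumes xy: "x < m * n" "y < m * n"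
  shows "gram (m * n) (two_block_mat m n A B) (two_block_mat m n A B) x y =
    (if x div n = y div n
     then gram n A A (x mod n) (y mod n) + (int m - 1) * gram n B B (x mod n) (y mod n)
     else gram n A B (x mod n) (y mod n) + gram n B A (x mod n) (y mod n)
       + (int m - 2) * gram n B B (x mod n) (y mod n))"
proof (cases "x div n = y div n")
  case True
  then have "(\<Sum>p<m. gram n (if x div n = p then A else B) (if y div n = p then A else B) (x mod n) (y mod n))
    = (\<Sum>p<m. if x div n = p then gram n A A (x mod n) (y mod n) else gram n B B (x mod n) (y mod n))"
    by (intro sum.cong) auto
  with True show ?thesis
    unfolding gram_two_block_mat[OF xy] using sum_if_one[OF div_mod_less(1)[OF xy(1)]] by simp
next
  case False
  then have "(\<Sum>p<m. gram n (if x div n = p then A else B) (if y div n = p then A else B) (x mod n) (y mod n))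
    = (\<Sum>p<m. if x div n = p then gram n A B (x mod n) (y mod n)
        else if y div n = p then gram n B A (x mod n) (y mod n) else gram n B B (x mod n) (y mod n))"
    by (intro sum.cong) auto
  with False show ?thesis
    unfolding gram_two_block_mat[OF xy]
    using sum_if_two[OF div_mod_less(1)[OF xy(1)] div_mod_less(1)[OF xy(2)]] by simp
qed

text \<open>This one computation supplies replications and block sizes (\<open>x = y\<close>), all
  concurrences, and the products of row blocks. The bound \<open>m \<ge> 2\<close> turns the integer
  coefficients into natural subtractions.\<close>

lemma gram_two_block_mat_compatible:
  assumes P: "compatible_pair n k1 l1 k2 l2 m1 m2 A B" and m: "m \<ge> 2"
    and xy: "x < m * n" "y < m * n"
  shows "gram (m * n) (two_block_mat m n A B) (two_block_mat m n A B) x y =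
    (if x = y then int (k1 + (m - 1) * k2)
     else if x div n = y div n then int (l1 + (m - 1) * l2)
     else if x mod n = y mod n then int ((m - 2) * k2 + m1)
     else int ((m - 2) * l2 + m2))"
proof -
  have A: "regular_design n k1 l1 A" and B: "regular_design n k2 l2 B"
    using P by (auto simp: compatible_pair_def)
  note b = div_mod_less(2)[OF xy(1)] div_mod_less(2)[OF xy(2)]
  have AB: "gram n A B (x mod n) (y mod n) + gram n B A (x mod n) (y mod n)
      = (if x mod n = y mod n then int m1 else int m2)"
    using P b by (simp add: compatible_pair_def)
  have eq: "x = y \<longleftrightarrow> x div n = y div n \<and> x mod n = y mod n"
    by (metis div_mult_mod_eq)
  show ?thesis
    unfolding gram_two_block_mat_cases[OF xy] AB regular_design_gram[OF A b] regular_design_gram[OF B b]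
    using m eq by (auto simp: of_nat_diff)
qed

lemma two_block_mat_incidence:
  assumes "incidence_matrix n n A" "incidence_matrix n n B"
  shows "incidence_matrix (m * n) (m * n) (two_block_mat m n A B)"
  using assms div_mod_less(2) by (auto simp: incidence_matrix_def two_block_mat_def)

lemma rectangular_design_two_block_mat:
  assumes P: "compatible_pair n k1 l1 k2 l2 m1 m2 A B" and m: "m \<ge> 2"
  shows "rectangular_design (m * n) (m * n) (k1 + (m - 1) * k2) (k1 + (m - 1) * k2)
    (l1 + (m - 1) * l2) ((m - 2) * k2 + m1) ((m - 2) * l2 + m2) m n (two_block_mat m n A B)"
proof -
  have inc: "incidence_matrix n n A" "incidence_matrix n n B"
    using P by (auto simp: compatible_pair_def regular_design_def)
  then have c: "A \<in> carrier_mat n n" "B \<in> carrier_mat n n"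
    by (auto simp: incidence_matrix_def)
  define N where "N = two_block_mat m n A B"
  \<comment> \<open>Block sizes are row sums of the transpose, which is the block matrix of the
    transposed pair.\<close>
  note P' = compatible_pair_transpose[OF P]
  have N: "incidence_matrix (m * n) (m * n) N"
    unfolding N_def by (rule two_block_mat_incidence[OF inc])
  have Nt: "transpose_mat N = two_block_mat m n (transpose_mat A) (transpose_mat B)"
    unfolding N_def by (rule two_block_mat_transpose[OF c])
  have rep: "replication N x = k1 + (m - 1) * k2" if "x < m * n" for x
  proof -
    have "int (replication N x) = int (k1 + (m - 1) * k2)"
      using replication_eq_sum[OF N that] gram_diag[OF N that]
        gram_two_block_mat_compatible[OF P m that that] by (simp add: N_def)
    then show ?thesis by (simp only: of_nat_eq_iff)
  qed
  have blk: "block_size N j = k1 + (m - 1) * k2" if j: "j < m * n" for j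
  proof -
    note Ni = incidence_matrix_transpose[OF N]
    have "int (block_size N j) = (\<Sum>x<m * n. transpose_mat N $$ (j, x))"
      using block_size_eq_sum[OF N j] N j by (auto simp: incidence_matrix_def intro!: sum.cong)
    then have "int (block_size N j) = int (k1 + (m - 1) * k2)"
      using gram_diag[OF Ni j] gram_two_block_mat_compatible[OF P' m j j] by (simp add: Nt)
    then show ?thesis by (simp only: of_nat_eq_iff)
  qed
  have con: "concurrence N x y = (if x div n = y div n then l1 + (m - 1) * l2
      else if x mod n = y mod n then (m - 2) * k2 + m1 else (m - 2) * l2 + m2)"
    (is "_ = ?c") if "x < m * n" "y < m * n" "x \<noteq> y" for x y
  proof -
    have "int (concurrence N x y) = int ?c"
      using concurrence_eq_gram[OF N that(1,2)] gram_two_block_mat_compatible[OF P m that(1,2)] that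
      by (simp add: N_def)
    then show ?thesis by (simp only: of_nat_eq_iff)
  qed
  show ?thesis
    using N rep blk con by (auto simp: rectangular_design_def N_def)
qed

section \<open>Products of row blocks and line sums of submatrices\<close>

lemma index_scalar_one_J:
  assumes "x < n" "y < n"
  shows "(int a \<cdot>\<^sub>m 1\<^sub>m n + int b \<cdot>\<^sub>m (J_mat n - 1\<^sub>m n)) $$ (x, y) = (if x = y then int a else int b)"
  using assms by (simp add: J_mat_def)

lemma row_block_gram:
  assumes N: "N \<in> carrier_mat (m * n) b" and ij: "i < m" "j < m"
    and g: "\<And>x y. x < n \<Longrightarrow> y < n \<Longrightarrow>
      gram b N N (i * n + x) (j * n + y) = (if x = y then int s else int t)"
  shows "row_block n N i * transpose_mat (row_block n N j) =
    int s \<cdot>\<^sub>m 1\<^sub>m n + int t \<cdot>\<^sub>m (J_mat n - 1\<^sub>m n)" (is "?L = ?R")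
proof (rule eq_matI)
  have c: "row_block n N i' \<in> carrier_mat n b" for i'
    using N by (simp add: row_block_def)
  fix x y assume "x < dim_row ?R" "y < dim_col ?R"
  then have xy: "x < n" "y < n" by (simp_all add: J_mat_def)
  have "gram b (row_block n N i) (row_block n N j) x y = gram b N N (i * n + x) (j * n + y)"
    using N xy by (simp add: gram_def row_block_def)
  then show "?L $$ (x, y) = ?R $$ (x, y)"
    unfolding gram_index[OF c c xy] index_scalar_one_J[OF xy] using g[OF xy] by simp
qed (use N in \<open>auto simp: row_block_def J_mat_def\<close>)

lemma global_decomposable_two_block_mat:
  assumes P: "compatible_pair n k1 l1 k2 l2 m1 m2 A B" and m: "m \<ge> 2"
  shows "global_decomposable (k1 + (m - 1) * k2)
    (l1 + (m - 1) * l2) ((m - 2) * k2 + m1) ((m - 2) * l2 + m2) m n (two_block_mat m n A B)"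
proof -
  let ?N = "two_block_mat m n A B"
  have AB: "symmetric_design n k1 l1 A" "symmetric_design n k2 l2 B"
    using P by (auto simp: compatible_pair_def regular_design_iff)
  then have c: "A \<in> carrier_mat n n" "B \<in> carrier_mat n n"
    by (auto simp: symmetric_design_def incidence_matrix_def)
  have "\<exists>k' l'. symmetric_design n k' l' (sub_block n (two_block_mat m n A B) i j)"
    if "i < m" "j < m" for i j
    using AB that by (auto simp: sub_block_two_block_mat[OF c])
  moreover have "row_block n ?N i * transpose_mat (row_block n ?N i) =
      int (k1 + (m - 1) * k2) \<cdot>\<^sub>m 1\<^sub>m n + int (l1 + (m - 1) * l2) \<cdot>\<^sub>m (J_mat n - 1\<^sub>m n)"
    if "i < m" for i
    using that by (intro row_block_gram[OF two_block_mat_carrier])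
      (simp_all add: gram_two_block_mat_compatible[OF P m] block_index_less)
  moreover have "row_block n ?N i * transpose_mat (row_block n ?N j) =
      int ((m - 2) * k2 + m1) \<cdot>\<^sub>m 1\<^sub>m n + int ((m - 2) * l2 + m2) \<cdot>\<^sub>m (J_mat n - 1\<^sub>m n)"
    if ij: "i < m" "j < m" "i \<noteq> j" for i j
  proof -
    \<comment> \<open>Different block rows contain no common treatment, so the case
      \<open>x = y\<close> of the Gram formula cannot occur, even for equal positions within the
      blocks.\<close>
    have "i * n + x \<noteq> j * n + y" if "x < n" "y < n" for x y
    proof
      assume "i * n + x = j * n + y"
      then have "(i * n + x) div n = (j * n + y) div n" by simp
      with that ij show False by simp
    qed
    with ij show ?thesis
      by (intro row_block_gram[OF two_block_mat_carrier])
        (simp_all add: gram_two_block_mat_compatible[OF P m] block_index_less)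
  qed
  ultimately show ?thesis
    unfolding global_decomposable_def by blast
qed

text \<open>Every submatrix is \<open>A\<close> or \<open>B\<close>, and regularity supplies the
  constant row sums that \<open>symmetric_design\<close> alone does not guarantee.\<close>

lemma STD_two_block_mat:
  assumes "regular_design n k1 l1 A" "regular_design n k2 l2 B"
  shows "STD n (two_block_mat m n A B)"
proof -
  have c: "A \<in> carrier_mat n n" "B \<in> carrier_mat n n"
    using assms by (auto simp: regular_design_def incidence_matrix_def)
  show ?thesis
    unfolding STD_def
  proof (intro exI[of _ m] conjI allI impI two_block_mat_carrier)
    fix i j assume "i < m" "j < m"
    with assms show "\<exists>s. \<forall>x<n. (\<Sum>y<n. sub_block n (two_block_mat m n A B) i j $$ (x, y)) = s"
      "\<exists>t. \<forall>y<n. (\<Sum>x<n. sub_block n (two_block_mat m n A B) i j $$ (x, y)) = t"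
      by (cases "i = j"; force simp: sub_block_two_block_mat[OF c] regular_design_def)+
  qed
qed

theorem theorem4:
  fixes n k1 k2 l1 l2 \<mu>\<^sub>1 \<mu>\<^sub>2 :: nat and N1 N2 :: "int mat"
  assumes "symmetric_design n k1 l1 N1"
    and "symmetric_design n k2 l2 N2"
    and "N1 * transpose_mat N2 + N2 * transpose_mat N1 =
           int \<mu>\<^sub>1 \<cdot>\<^sub>m 1\<^sub>m n + int \<mu>\<^sub>2 \<cdot>\<^sub>m (J_mat n - 1\<^sub>m n)"
  shows "\<forall>m::nat. m \<ge> 2 \<longrightarrow>
    (\<exists>N. self_dual_rectangular_design
           (m * n) (m * n) (k1 + (m - 1) * k2) (k1 + (m - 1) * k2)
           (l1 + (m - 1) * l2) ((m - 2) * k2 + \<mu>\<^sub>1) ((m - 2) * l2 + \<mu>\<^sub>2) m n N \<and>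
         STD n N \<and>
         global_decomposable (k1 + (m - 1) * k2)
           (l1 + (m - 1) * l2) ((m - 2) * k2 + \<mu>\<^sub>1) ((m - 2) * l2 + \<mu>\<^sub>2) m n N)"
proof (intro allI impI)
  fix m :: nat assume m: "m \<ge> 2"
  have c: "N1 \<in> carrier_mat n n" "N2 \<in> carrier_mat n n"
    using assms(1,2) by (auto simp: symmetric_design_def incidence_matrix_def)
  have "gram n N1 N2 x y + gram n N2 N1 x y = (if x = y then int \<mu>\<^sub>1 else int \<mu>\<^sub>2)"
    if xy: "x < n" "y < n" for x y
  proof -
    have "gram n N1 N2 x y + gram n N2 N1 x y
        = (N1 * transpose_mat N2 + N2 * transpose_mat N1) $$ (x, y)"
      using c xy gram_index[OF c xy] gram_index[OF c(2,1) xy] by simp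
    then show ?thesis
      unfolding assms(3) using index_scalar_one_J[OF xy] by simp
  qed
  \<comment> \<open>\<open>A\<close> and \<open>B\<close> may differ from \<open>N1\<close> and
    \<open>N2\<close>; they share the parameters, and only these enter the conclusion.\<close>
  then obtain A B where P: "compatible_pair n k1 l1 k2 l2 \<mu>\<^sub>1 \<mu>\<^sub>2 A B"
    using exists_compatible_pair[OF assms(1,2)] by blast
  then have R: "regular_design n k1 l1 A" "regular_design n k2 l2 B"
    by (auto simp: compatible_pair_def)
  then have cAB: "A \<in> carrier_mat n n" "B \<in> carrier_mat n n"
    by (auto simp: regular_design_def incidence_matrix_def)
  show "\<exists>N. self_dual_rectangular_design
           (m * n) (m * n) (k1 + (m - 1) * k2) (k1 + (m - 1) * k2)
           (l1 + (m - 1) * l2) ((m - 2) * k2 + \<mu>\<^sub>1) ((m - 2) * l2 + \<mu>\<^sub>2) m n N \<and>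
         STD n N \<and>
         global_decomposable (k1 + (m - 1) * k2)
           (l1 + (m - 1) * l2) ((m - 2) * k2 + \<mu>\<^sub>1) ((m - 2) * l2 + \<mu>\<^sub>2) m n N"
  proof (intro exI[of _ "two_block_mat m n A B"] conjI)
    \<comment> \<open>The transpose is the same construction applied to the transposed pair, which
      is compatible with identical parameters.\<close>
    show "self_dual_rectangular_design
           (m * n) (m * n) (k1 + (m - 1) * k2) (k1 + (m - 1) * k2)
           (l1 + (m - 1) * l2) ((m - 2) * k2 + \<mu>\<^sub>1) ((m - 2) * l2 + \<mu>\<^sub>2) m n
           (two_block_mat m n A B)"
      unfolding self_dual_rectangular_design_def two_block_mat_transpose[OF cAB]
      using rectangular_design_two_block_mat[OF P m]
        rectangular_design_two_block_mat[OF compatible_pair_transpose[OF P] m] by blast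
  qed (use STD_two_block_mat[OF R] global_decomposable_two_block_mat[OF P m] in simp_all)
qed

end
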